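(* Let $(\Omega,\mathcal{F},\mathbb{P})$ be a probability space, let $\theta>0$ and $x_0\in\mathbb{R}$, and consider a complete market whose unique pricing kernel $M$ is a random variable with $M>0$ $\mathbb{P}$-a.s. and $\mathbb{E}[M^2]<\infty$. Then the solutions to the mean-variance problem $$\max_{X}\ U_\theta(X)\quad\text{subject to } X\in L^2(\mathbb{P}),\ \mathbb{E}[MX]=x_0,$$ and to the monotone mean-variance problem $$\max_{X}\ V_\theta(X)\quad\text{subject to } X\in L^2(\mathbb{P}),\ \mathbb{E}[MX]=x_0,$$ are the same; that is, a terminal wealth $X$ with $\mathbb{E}[MX]=x_0$ is optimal for the first problem if and only if it is optimal for the second.
   Context: $\mathbb{E}$ denotes expectation under $\mathbb{P}$. In a complete market with pricing kernel $M$ and initial endowment $x_0$, the terminal wealths attainable by admissible self-financing strategies are exactly the claims $X\in L^2(\mathbb{P})$ with $\mathbb{E}[MX]=x_0$. Mean-variance (MV) preference with uncertainty aversion coefficient $\theta>0$: $U_\theta(X)=\mathbb{E}[X]-\frac{\theta}{2}\mathrm{Var}(X)$ for $X\in L^2(\mathbb{P})$. Monotone mean-variance (MMV) preference: for $X\in L^2(\mathbb{P})$, $$V_\theta(X)=\inf_{\mathbb{Q}\in\Delta^2(\mathbb{P})}\left\{\mathbb{E}^{\mathbb{Q}}[X]+\frac{1}{2\theta}\left(\mathbb{E}\left[\left(\frac{\mathrm{d}\mathbb{Q}}{\mathrm{d}\mathbb{P}}\right)^2\right]-1\right)\right\},$$ where $\Delta^2(\mathbb{P})$ is the set of probability measures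 $\mathbb{Q}\ll\mathbb{P}$ with $\mathbb{E}\left[\left(\mathrm{d}\mathbb{Q}/\mathrm{d}\mathbb{P}\right)^2\right]<\infty$. *)

theory Defs
  imports "HOL-Probability.Probability"
begin

definition L2 :: "'a measure \<Rightarrow> ('a \<Rightarrow> real) set" where
  "L2 P = {X \<in> borel_measurable P. integrable P (\<lambda>\<omega>. (X \<omega>)\<^sup>2)}"

text \<open>Complete market: the budget equation for the pricing kernel \<open>M\<close> characterises the terminal
  wealths that can be attained from the endowment \<open>x0\<close>.\<close>

definition attainable :: "'a measure \<Rightarrow> ('a \<Rightarrow> real) \<Rightarrow> real \<Rightarrow> ('a \<Rightarrow> real) set" where
  "attainable P M x0 = {X \<in> L2 P. (\<integral>\<omega>. M \<omega> * X \<omega> \<partial>P) = x0}"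

definition mv_utility :: "'a measure \<Rightarrow> real \<Rightarrow> ('a \<Rightarrow> real) \<Rightarrow> real" where
  "mv_utility P \<theta> X = prob_space.expectation P X - \<theta> / 2 * prob_space.variance P X"

text \<open>The library's Radon-Nikodym derivative takes values in \<^typ>\<open>ennreal\<close>; between
  \<open>\<sigma>\<close>-finite measures it is finite almost everywhere, so nothing is lost by passing to reals.\<close>

definition dens :: "'a measure \<Rightarrow> 'a measure \<Rightarrow> 'a \<Rightarrow> real" where
  "dens P Q \<omega> = enn2real (RN_deriv P Q \<omega>)"

definition Delta2 :: "'a measure \<Rightarrow> 'a measure set" where
  "Delta2 P = {Q. prob_space Q \<and> sets Q = sets P \<and> absolutely_continuous P Q
                  \<and> integrable P (\<lambda>\<omega>. (dens P Q \<omega>)\<^sup>2)}"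

definition mmv_penalised :: "'a measure \<Rightarrow> real \<Rightarrow> ('a \<Rightarrow> real) \<Rightarrow> 'a measure \<Rightarrow> real" where
  "mmv_penalised P \<theta> X Q =
     prob_space.expectation Q X
       + 1 / (2 * \<theta>) * (prob_space.expectation P (\<lambda>\<omega>. (dens P Q \<omega>)\<^sup>2) - 1)"

text \<open>The infimum is taken in the reals; \<open>Delta2_nonempty\<close> and \<open>mmv_penalised_bdd_below\<close> below
  show that it is a genuine infimum.\<close>

definition mmv_utility :: "'a measure \<Rightarrow> real \<Rightarrow> ('a \<Rightarrow> real) \<Rightarrow> real" where
  "mmv_utility P \<theta> X = (INF Q \<in> Delta2 P. mmv_penalised P \<theta> X Q)"

lemma Delta2_nonempty:
  assumes "prob_space P"
  shows "P \<in> Delta2 P"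
proof -
  interpret P: prob_space P by fact
  have "AE \<omega> in P. 1 = RN_deriv P P \<omega>"
    by (rule P.RN_deriv_unique) (auto simp: density_1)
  then have ae: "AE \<omega> in P. (dens P P \<omega>)\<^sup>2 = 1"
    by eventually_elim (auto simp: dens_def)
  have [measurable]: "(\<lambda>\<omega>. (dens P P \<omega>)\<^sup>2) \<in> borel_measurable P"
    unfolding dens_def by measurable
  have "integrable P (\<lambda>\<omega>. (dens P P \<omega>)\<^sup>2)"
    using ae by (subst integrable_cong_AE[where g = "\<lambda>_. 1"]) auto
  then show ?thesis
    by (auto simp: Delta2_def absolutely_continuous_def assms)
qed

lemma mmv_penalised_bdd_below:
  assumes "prob_space P" and "\<theta> > 0" and "X \<in> L2 P"
  shows "bdd_below (mmv_penalised P \<theta> X ` Delta2 P)"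
proof (rule bdd_belowI2)
  fix Q assume Q: "Q \<in> Delta2 P"
  interpret P: prob_space P by fact
  interpret Q: prob_space Q using Q by (simp add: Delta2_def)
  let ?Z = "dens P Q"
  have ac: "absolutely_continuous P Q" and sQ: "sets Q = sets P"
    and iZ: "integrable P (\<lambda>\<omega>. (?Z \<omega>)\<^sup>2)" using Q by (auto simp: Delta2_def)
  have [measurable]: "X \<in> borel_measurable P" and iX: "integrable P (\<lambda>\<omega>. (X \<omega>)\<^sup>2)"
    using assms by (auto simp: L2_def)
  have [measurable]: "?Z \<in> borel_measurable P" unfolding dens_def by measurable
  have sq: "0 \<le> \<theta> / 2 * x\<^sup>2 + 1 / (2 * \<theta>) * z\<^sup>2 + z * x" for x z :: real
  proof -
    have "0 \<le> \<theta> / 2 * (x + z / \<theta>)\<^sup>2" using assms(2) by simp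
    also have "\<dots> = \<theta> / 2 * x\<^sup>2 + 1 / (2 * \<theta>) * z\<^sup>2 + z * x"
      using assms(2) by (simp add: field_simps power2_eq_square)
    finally show ?thesis .
  qed
  have iZX: "integrable P (\<lambda>\<omega>. ?Z \<omega> * X \<omega>)"
  proof (rule Bochner_Integration.integrable_bound)
    show "integrable P (\<lambda>\<omega>. (?Z \<omega>)\<^sup>2 + (X \<omega>)\<^sup>2)" using iZ iX by simp
    show "AE \<omega> in P. norm (?Z \<omega> * X \<omega>) \<le> norm ((?Z \<omega>)\<^sup>2 + (X \<omega>)\<^sup>2)"
    proof (rule AE_I2)
      fix \<omega>
      have "2 * (\<bar>?Z \<omega>\<bar> * \<bar>X \<omega>\<bar>) \<le> (?Z \<omega>)\<^sup>2 + (X \<omega>)\<^sup>2"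
        using sum_squares_bound[of "\<bar>?Z \<omega>\<bar>" "\<bar>X \<omega>\<bar>"] by simp
      moreover have "0 \<le> \<bar>?Z \<omega>\<bar> * \<bar>X \<omega>\<bar>" by simp
      ultimately show "norm (?Z \<omega> * X \<omega>) \<le> norm ((?Z \<omega>)\<^sup>2 + (X \<omega>)\<^sup>2)"
        unfolding real_norm_def abs_mult by linarith
    qed
  qed simp
  have "(\<integral>\<omega>. X \<omega> \<partial>Q) = (\<integral>\<omega>. ?Z \<omega> * X \<omega> \<partial>P)"
    unfolding dens_def
    by (rule P.RN_deriv_integral[OF _ ac sQ]) (auto intro: Q.sigma_finite_measure_axioms)
  moreover have "0 \<le> (\<integral>\<omega>. \<theta> / 2 * (X \<omega>)\<^sup>2 + 1 / (2 * \<theta>) * (?Z \<omega>)\<^sup>2 + ?Z \<omega> * X \<omega> \<partial>P)"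
    by (rule Bochner_Integration.integral_nonneg) (rule sq)
  moreover have "\<dots> = \<theta> / 2 * (\<integral>\<omega>. (X \<omega>)\<^sup>2 \<partial>P) + 1 / (2 * \<theta>) * (\<integral>\<omega>. (?Z \<omega>)\<^sup>2 \<partial>P)
      + (\<integral>\<omega>. ?Z \<omega> * X \<omega> \<partial>P)"
    using iX iZ iZX by simp
  ultimately show "- (\<theta> / 2 * (\<integral>\<omega>. (X \<omega>)\<^sup>2 \<partial>P)) - 1 / (2 * \<theta>) \<le> mmv_penalised P \<theta> X Q"
    unfolding mmv_penalised_def by (simp add: right_diff_distrib)
qed

end

theory Submission
  imports Defs
begin

text \<open>Completing the square, for a density \<open>Z\<close> the penalised expectation of \<open>X\<close> equals
  \<open>U\<^sub>\<theta>(X) + E[(Z - 1 + \<theta> (X - E[X]))\<^sup>2] / (2 \<theta>)\<close>; hence \<open>U\<^sub>\<theta> \<le> V\<^sub>\<theta>\<close>. At the pricing density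
  \<open>M / E[M]\<close> the penalised expectation is one constant \<open>C\<close> on all attainable claims, so
  \<open>U\<^sub>\<theta> \<le> V\<^sub>\<theta> \<le> C\<close> there, and \<open>U\<^sub>\<theta>\<close> attains \<open>C\<close> at a claim affine in \<open>M\<close>. Finally \<open>V\<^sub>\<theta>(X) = C\<close>
  says that \<open>M / E[M]\<close> minimises the convex penalised problem over densities; since it is
  strictly positive, the first-order condition forces the square to vanish, so \<open>U\<^sub>\<theta>(X) = C\<close>.\<close>

section \<open>Closure properties of square-integrable functions\<close>

lemma L2_mult_integrable:
  assumes "f \<in> L2 P" and "g \<in> L2 P"
  shows "integrable P (\<lambda>\<omega>. f \<omega> * g \<omega>)"
proof (rule Bochner_Integration.integrable_bound)
  show "integrable P (\<lambda>\<omega>. (f \<omega>)\<^sup>2 + (g \<omega>)\<^sup>2)" and "(\<lambda>\<omega>. f \<omega> * g \<omega>) \<in> borel_measurable P"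
    using assms by (auto simp: L2_def)
  show "AE \<omega> in P. norm (f \<omega> * g \<omega>) \<le> norm ((f \<omega>)\<^sup>2 + (g \<omega>)\<^sup>2)"
  proof (rule AE_I2)
    fix \<omega>
    have "2 * (\<bar>f \<omega>\<bar> * \<bar>g \<omega>\<bar>) \<le> (f \<omega>)\<^sup>2 + (g \<omega>)\<^sup>2"
      using sum_squares_bound[of "\<bar>f \<omega>\<bar>" "\<bar>g \<omega>\<bar>"] by simp
    moreover have "0 \<le> \<bar>f \<omega>\<bar> * \<bar>g \<omega>\<bar>" by simp
    ultimately show "norm (f \<omega> * g \<omega>) \<le> norm ((f \<omega>)\<^sup>2 + (g \<omega>)\<^sup>2)"
      unfolding real_norm_def abs_mult by linarith
  qed
qed

lemma L2_const:
  assumes "prob_space P"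
  shows "(\<lambda>_. c) \<in> L2 P"
proof -
  interpret prob_space P by fact
  show ?thesis by (simp add: L2_def)
qed

lemma L2_integrable:
  assumes "prob_space P" and "f \<in> L2 P"
  shows "integrable P f"
  using L2_mult_integrable[OF assms(2) L2_const[OF assms(1), of 1]] by simp

lemma L2_cmult: "f \<in> L2 P \<Longrightarrow> (\<lambda>\<omega>. c * f \<omega>) \<in> L2 P"
  by (auto simp: L2_def power_mult_distrib)

lemma L2_add:
  assumes "f \<in> L2 P" and "g \<in> L2 P"
  shows "(\<lambda>\<omega>. f \<omega> + g \<omega>) \<in> L2 P"
proof -
  have "integrable P (\<lambda>\<omega>. (f \<omega>)\<^sup>2 + (g \<omega>)\<^sup>2 + 2 * (f \<omega> * g \<omega>))"
    using assms L2_mult_integrable[OF assms] by (auto simp: L2_def)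
  then show ?thesis
    using assms by (auto simp: L2_def power2_sum mult.assoc)
qed

lemma L2_diff:
  assumes "f \<in> L2 P" and "g \<in> L2 P"
  shows "(\<lambda>\<omega>. f \<omega> - g \<omega>) \<in> L2 P"
  using L2_add[OF assms(1) L2_cmult[OF assms(2), of "-1"]] by simp

section \<open>From measures in \<open>Delta2\<close> to square-integrable densities\<close>

definition L2_densities :: "'a measure \<Rightarrow> ('a \<Rightarrow> real) set" where
  "L2_densities P = {Z \<in> L2 P. (AE \<omega> in P. 0 \<le> Z \<omega>) \<and> (\<integral>\<omega>. Z \<omega> \<partial>P) = 1}"

definition penalised_at :: "'a measure \<Rightarrow> real \<Rightarrow> ('a \<Rightarrow> real) \<Rightarrow> ('a \<Rightarrow> real) \<Rightarrow> real" where
  "penalised_at P \<theta> X Z =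
     (\<integral>\<omega>. Z \<omega> * X \<omega> \<partial>P) + 1 / (2 * \<theta>) * ((\<integral>\<omega>. (Z \<omega>)\<^sup>2 \<partial>P) - 1)"

text \<open>Integrals under \<open>Q\<close> are \<open>P\<close>-integrals weighted by
  \<open>dens P Q\<close>; the constant integrand 1 gives the normalisation. Together with
  \<open>density_in_Delta2\<close>, this turns the infimum over measures into one over functions,
  where segments and perturbations are easy to form.\<close>

lemma dens_in_L2_densities:
  assumes P: "prob_space P" and Q: "Q \<in> Delta2 P"
  shows "dens P Q \<in> L2_densities P"
    and "X \<in> borel_measurable P \<Longrightarrow> mmv_penalised P \<theta> X Q = penalised_at P \<theta> X (dens P Q)"
proof -
  interpret P: prob_space P by fact
  interpret Q: prob_space Q using Q by (simp add: Delta2_def)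
  have ac: "absolutely_continuous P Q" and sQ: "sets Q = sets P"
    and iZ: "integrable P (\<lambda>\<omega>. (dens P Q \<omega>)\<^sup>2)" using Q by (auto simp: Delta2_def)
  have int: "(\<integral>\<omega>. Y \<omega> \<partial>Q) = (\<integral>\<omega>. dens P Q \<omega> * Y \<omega> \<partial>P)" if "Y \<in> borel_measurable P" for Y
    unfolding dens_def
    by (rule P.RN_deriv_integral[OF _ ac sQ that]) (auto intro: Q.sigma_finite_measure_axioms)
  have "(\<integral>\<omega>. dens P Q \<omega> \<partial>P) = 1"
    using int[of "\<lambda>_. 1"] by (simp add: Q.prob_space)
  moreover have "dens P Q \<in> borel_measurable P" unfolding dens_def by measurable
  ultimately show "dens P Q \<in> L2_densities P"
    using iZ by (simp add: L2_densities_def L2_def) (simp add: dens_def)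
  show "mmv_penalised P \<theta> X Q = penalised_at P \<theta> X (dens P Q)" if "X \<in> borel_measurable P"
    using int[OF that] by (simp add: mmv_penalised_def penalised_at_def)
qed

text \<open>Uniqueness of the Radon-Nikodym derivative identifies
  \<open>dens P (density P Z)\<close> with \<open>Z\<close> almost everywhere, so membership and
  penalty can be read off from \<open>Z\<close> itself.\<close>

lemma density_in_Delta2:
  assumes P: "prob_space P" and Z: "Z \<in> L2_densities P"
  shows "density P Z \<in> Delta2 P"
    and "X \<in> borel_measurable P \<Longrightarrow> mmv_penalised P \<theta> X (density P Z) = penalised_at P \<theta> X Z"
proof -
  interpret P: prob_space P by fact
  have [measurable]: "Z \<in> borel_measurable P" and iZ2: "integrable P (\<lambda>\<omega>. (Z \<omega>)\<^sup>2)"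
    and pos: "AE \<omega> in P. 0 \<le> Z \<omega>" and one: "(\<integral>\<omega>. Z \<omega> \<partial>P) = 1" and "Z \<in> L2 P"
    using Z by (auto simp: L2_densities_def L2_def)
  note iZ = L2_integrable[OF P \<open>Z \<in> L2 P\<close>]
  have rn: "AE \<omega> in P. ennreal (Z \<omega>) = RN_deriv P (density P Z) \<omega>"
    by (rule P.RN_deriv_unique) auto
  \<comment> \<open>\<open>ennreal\<close> sends negative reals to 0, so \<open>enn2real\<close>
    recovers \<open>Z\<close> only where \<open>Z\<close> is nonnegative.\<close>
  then have ae: "AE \<omega> in P. dens P (density P Z) \<omega> = Z \<omega>"
    using pos rn by eventually_elim (simp add: dens_def, metis enn2real_ennreal)
  have [measurable]: "dens P (density P Z) \<in> borel_measurable P"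
    unfolding dens_def by measurable
  have ae2: "AE \<omega> in P. (dens P (density P Z) \<omega>)\<^sup>2 = (Z \<omega>)\<^sup>2"
    using ae by eventually_elim simp
  have "emeasure (density P Z) (space P) = (\<integral>\<^sup>+\<omega>. ennreal (Z \<omega>) \<partial>P)"
    by (subst emeasure_density) (auto intro!: nn_integral_cong)
  also have "\<dots> = 1"
    using nn_integral_eq_integral[OF iZ pos] one by simp
  finally have "prob_space (density P Z)" by (intro prob_spaceI) simp
  moreover have "absolutely_continuous P (density P Z)"
    by (rule absolutely_continuousI_density) simp
  moreover have "integrable P (\<lambda>\<omega>. (dens P (density P Z) \<omega>)\<^sup>2)"
    using iZ2 ae2 by (subst integrable_cong_AE[where g = "\<lambda>\<omega>. (Z \<omega>)\<^sup>2"]) auto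
  ultimately show "density P Z \<in> Delta2 P" by (simp add: Delta2_def)
  show "mmv_penalised P \<theta> X (density P Z) = penalised_at P \<theta> X Z"
    if [measurable]: "X \<in> borel_measurable P"
  proof -
    have "(\<integral>\<omega>. (dens P (density P Z) \<omega>)\<^sup>2 \<partial>P) = (\<integral>\<omega>. (Z \<omega>)\<^sup>2 \<partial>P)"
      using ae2 by (intro integral_cong_AE) auto
    moreover have "(\<integral>\<omega>. X \<omega> \<partial>density P Z) = (\<integral>\<omega>. Z \<omega> * X \<omega> \<partial>P)"
      using pos by (subst integral_density) auto
    ultimately show ?thesis by (simp add: mmv_penalised_def penalised_at_def)
  qed
qed

text \<open>Every such \<open>Z\<close> supplies the competitor \<open>density P Z\<close>;
  boundedness from below makes the real-valued \<open>INF\<close> a true lower bound for it.\<close>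

lemma mmv_utility_le_penalised_at:
  assumes "prob_space P" and "\<theta> > 0" and "X \<in> L2 P" and "Z \<in> L2_densities P"
  shows "mmv_utility P \<theta> X \<le> penalised_at P \<theta> X Z"
proof -
  have "mmv_utility P \<theta> X \<le> mmv_penalised P \<theta> X (density P Z)"
    unfolding mmv_utility_def
    by (rule cINF_lower[OF mmv_penalised_bdd_below density_in_Delta2(1)]) (use assms in auto)
  also have "\<dots> = penalised_at P \<theta> X Z"
    using assms by (intro density_in_Delta2(2)) (auto simp: L2_def)
  finally show ?thesis .
qed

section \<open>Completing the square in the penalised expectation\<close>

definition mv_residual :: "'a measure \<Rightarrow> real \<Rightarrow> ('a \<Rightarrow> real) \<Rightarrow> ('a \<Rightarrow> real) \<Rightarrow> 'a \<Rightarrow> real" where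
  "mv_residual P \<theta> X Z \<omega> = Z \<omega> - 1 + \<theta> * (X \<omega> - (\<integral>\<omega>. X \<omega> \<partial>P))"

lemma mv_residual_L2:
  assumes "prob_space P" and "X \<in> L2 P" and "Z \<in> L2 P"
  shows "mv_residual P \<theta> X Z \<in> L2 P"
  unfolding mv_residual_def[abs_def]
  by (intro L2_add L2_diff L2_cmult L2_const assms)

text \<open>Expand the square with the centred claim \<open>Y\<close>. Since \<open>Z\<close> has
  mean 1, the cross term E[ZY] equals E[ZX] - E[X], which exchanges the mean of \<open>X\<close>
  under \<open>P\<close> for the one weighted by \<open>Z\<close>; the term in E[Y^2] cancels the
  variance penalty.\<close>

lemma penalised_at_eq:
  assumes P: "prob_space P" and "\<theta> > 0" and X: "X \<in> L2 P"
    and Z: "Z \<in> L2 P" and one: "(\<integral>\<omega>. Z \<omega> \<partial>P) = 1"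
  shows "penalised_at P \<theta> X Z =
    mv_utility P \<theta> X + 1 / (2 * \<theta>) * (\<integral>\<omega>. (mv_residual P \<theta> X Z \<omega>)\<^sup>2 \<partial>P)"
proof -
  interpret prob_space P by fact
  let ?m = "\<integral>\<omega>. X \<omega> \<partial>P"
  define Y where "Y = (\<lambda>\<omega>. X \<omega> - ?m)"
  have Y: "Y \<in> L2 P" unfolding Y_def by (intro L2_diff L2_const P X)
  note i [simp] = L2_integrable[OF P X] L2_integrable[OF P Z] L2_integrable[OF P Y]
    L2_mult_integrable[OF Z X] L2_mult_integrable[OF Z Y]
  have i2 [simp]: "integrable P (\<lambda>\<omega>. (Z \<omega>)\<^sup>2)" "integrable P (\<lambda>\<omega>. (Y \<omega>)\<^sup>2)"
    using Z Y by (auto simp: L2_def)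
  have Y0: "(\<integral>\<omega>. Y \<omega> \<partial>P) = 0" by (simp add: Y_def prob_space)
  have ZY: "(\<integral>\<omega>. Z \<omega> * Y \<omega> \<partial>P) = (\<integral>\<omega>. Z \<omega> * X \<omega> \<partial>P) - ?m"
  proof -
    have "(\<integral>\<omega>. Z \<omega> * Y \<omega> \<partial>P) = (\<integral>\<omega>. Z \<omega> * X \<omega> - ?m * Z \<omega> \<partial>P)"
      by (simp add: Y_def algebra_simps)
    also have "\<dots> = (\<integral>\<omega>. Z \<omega> * X \<omega> \<partial>P) - (\<integral>\<omega>. ?m * Z \<omega> \<partial>P)"
      by (rule Bochner_Integration.integral_diff) simp_all
    finally show ?thesis using one by simp
  qed
  have "(\<integral>\<omega>. (mv_residual P \<theta> X Z \<omega>)\<^sup>2 \<partial>P) =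
      (\<integral>\<omega>. (Z \<omega>)\<^sup>2 + \<theta>\<^sup>2 * (Y \<omega>)\<^sup>2 + 2 * \<theta> * (Z \<omega> * Y \<omega>) - 2 * Z \<omega> - 2 * \<theta> * Y \<omega> + 1 \<partial>P)"
    by (intro Bochner_Integration.integral_cong)
      (simp_all add: mv_residual_def Y_def power2_eq_square algebra_simps)
  \<comment> \<open>The final -1 is -2 E[Z] + 1; it matches the -1 in the penalty of
    \<open>penalised_at\<close>.\<close>
  also have "\<dots> = (\<integral>\<omega>. (Z \<omega>)\<^sup>2 \<partial>P) + \<theta>\<^sup>2 * (\<integral>\<omega>. (Y \<omega>)\<^sup>2 \<partial>P)
      + 2 * \<theta> * ((\<integral>\<omega>. Z \<omega> * X \<omega> \<partial>P) - ?m) - 1"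
    by (simp add: one Y0 ZY prob_space)
  finally show ?thesis
    using \<open>\<theta> > 0\<close>
    by (simp add: penalised_at_def mv_utility_def Y_def field_simps power2_eq_square)
qed

text \<open>By \<open>penalised_at_eq\<close>, each value in the infimum is the mean-variance value
  plus a nonnegative multiple of an integrated square.\<close>

lemma mv_utility_le_mmv_utility:
  assumes P: "prob_space P" and "\<theta> > 0" and X: "X \<in> L2 P"
  shows "mv_utility P \<theta> X \<le> mmv_utility P \<theta> X"
  unfolding mmv_utility_def
proof (rule cINF_greatest)
  show "Delta2 P \<noteq> {}" using Delta2_nonempty[OF P] by blast
  fix Q assume Q: "Q \<in> Delta2 P"
  have "dens P Q \<in> L2_densities P" by (rule dens_in_L2_densities(1)[OF P Q])
  then have "penalised_at P \<theta> X (dens P Q) = mv_utility P \<theta> X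
      + 1 / (2 * \<theta>) * (\<integral>\<omega>. (mv_residual P \<theta> X (dens P Q) \<omega>)\<^sup>2 \<partial>P)"
    by (intro penalised_at_eq assms) (auto simp: L2_densities_def)
  moreover have "0 \<le> 1 / (2 * \<theta>) * (\<integral>\<omega>. (mv_residual P \<theta> X (dens P Q) \<omega>)\<^sup>2 \<partial>P)"
    using \<open>\<theta> > 0\<close> by simp
  moreover have "mmv_penalised P \<theta> X Q = penalised_at P \<theta> X (dens P Q)"
    using X by (intro dens_in_L2_densities(2)[OF P Q]) (simp add: L2_def)
  ultimately show "mv_utility P \<theta> X \<le> mmv_penalised P \<theta> X Q" by simp
qed

section \<open>The first-order condition at a minimising density\<close>

lemma L2_densities_convex:
  assumes P: "prob_space P" and Z: "Z \<in> L2_densities P" and Z': "Z' \<in> L2_densities P"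
    and t: "0 \<le> t" "t \<le> 1"
  shows "(\<lambda>\<omega>. Z \<omega> + t * (Z' \<omega> - Z \<omega>)) \<in> L2_densities P"
proof -
  have L: "Z \<in> L2 P" "Z' \<in> L2 P" and pos: "AE \<omega> in P. 0 \<le> Z \<omega>" "AE \<omega> in P. 0 \<le> Z' \<omega>"
    and one: "(\<integral>\<omega>. Z \<omega> \<partial>P) = 1" "(\<integral>\<omega>. Z' \<omega> \<partial>P) = 1"
    using Z Z' by (auto simp: L2_densities_def)
  have "AE \<omega> in P. 0 \<le> Z \<omega> + t * (Z' \<omega> - Z \<omega>)"
    using pos
  proof eventually_elim
    case (elim \<omega>)
    then have "0 \<le> (1 - t) * Z \<omega> + t * Z' \<omega>" using t by simp
    then show ?case by (simp add: algebra_simps)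
  qed
  then show ?thesis
    using one L2_integrable[OF P L(1)] L2_integrable[OF P L(2)]
    by (auto simp: L2_densities_def intro!: L2_add L2_cmult L2_diff L)
qed

text \<open>Up to an additive constant, the residual is \<theta> times the gradient X + Z/\<theta>
  of \<open>penalised_at\<close> in \<open>Z\<close>, and the constant is invisible to directions
  \<open>H\<close> of mean zero. Along the segment from \<open>Z\<close> to \<open>Z'\<close> the
  integrated square changes by t(2a + tb); minimality at t = 0 makes 2a + tb nonnegative for all
  small positive t, hence a as well.\<close>

lemma penalised_at_minimiser_first_order:
  assumes P: "prob_space P" and "\<theta> > 0" and X: "X \<in> L2 P"
    and Z: "Z \<in> L2_densities P" and Z': "Z' \<in> L2_densities P"
    and min: "\<And>Z'. Z' \<in> L2_densities P \<Longrightarrow> penalised_at P \<theta> X Z \<le> penalised_at P \<theta> X Z'"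
  shows "(\<integral>\<omega>. mv_residual P \<theta> X Z \<omega> * Z \<omega> \<partial>P) \<le> (\<integral>\<omega>. mv_residual P \<theta> X Z \<omega> * Z' \<omega> \<partial>P)"
proof -
  let ?R = "mv_residual P \<theta> X Z"
  define H where "H = (\<lambda>\<omega>. Z' \<omega> - Z \<omega>)"
  have L: "Z \<in> L2 P" "Z' \<in> L2 P" using Z Z' by (auto simp: L2_densities_def)
  have R: "?R \<in> L2 P" by (rule mv_residual_L2[OF P X L(1)])
  have H: "H \<in> L2 P" unfolding H_def by (intro L2_diff L)
  note [simp] = L2_mult_integrable[OF R H]
  have [simp]: "integrable P (\<lambda>\<omega>. (?R \<omega>)\<^sup>2)" "integrable P (\<lambda>\<omega>. (H \<omega>)\<^sup>2)"
    using R H by (auto simp: L2_def)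
  define a where "a = (\<integral>\<omega>. ?R \<omega> * H \<omega> \<partial>P)"
  define b where "b = (\<integral>\<omega>. (H \<omega>)\<^sup>2 \<partial>P)"
  have b: "0 \<le> b" by (simp add: b_def)
  have key: "0 \<le> 2 * a + t * b" if t: "0 < t" "t \<le> 1" for t
  proof -
    let ?W = "\<lambda>\<omega>. Z \<omega> + t * (Z' \<omega> - Z \<omega>)"
    have W: "?W \<in> L2_densities P" using t by (intro L2_densities_convex P Z Z') auto
    have "(\<integral>\<omega>. (mv_residual P \<theta> X ?W \<omega>)\<^sup>2 \<partial>P) =
        (\<integral>\<omega>. (?R \<omega>)\<^sup>2 + 2 * t * (?R \<omega> * H \<omega>) + t\<^sup>2 * (H \<omega>)\<^sup>2 \<partial>P)"
      by (intro Bochner_Integration.integral_cong)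
        (simp_all add: mv_residual_def H_def power2_eq_square algebra_simps)
    also have "\<dots> = (\<integral>\<omega>. (?R \<omega>)\<^sup>2 \<partial>P) + 2 * t * a + t\<^sup>2 * b"
      by (simp add: a_def b_def)
    finally have W2: "(\<integral>\<omega>. (mv_residual P \<theta> X ?W \<omega>)\<^sup>2 \<partial>P) = \<dots>" .
    have eq: "penalised_at P \<theta> X V =
        mv_utility P \<theta> X + 1 / (2 * \<theta>) * (\<integral>\<omega>. (mv_residual P \<theta> X V \<omega>)\<^sup>2 \<partial>P)"
      if "V \<in> L2_densities P" for V
      using that by (intro penalised_at_eq assms) (auto simp: L2_densities_def)
    have "1 / (2 * \<theta>) * (\<integral>\<omega>. (?R \<omega>)\<^sup>2 \<partial>P)
        \<le> 1 / (2 * \<theta>) * (\<integral>\<omega>. (mv_residual P \<theta> X ?W \<omega>)\<^sup>2 \<partial>P)"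
      using min[OF W] unfolding eq[OF W] eq[OF Z] by simp
    then have "(\<integral>\<omega>. (?R \<omega>)\<^sup>2 \<partial>P) \<le> (\<integral>\<omega>. (mv_residual P \<theta> X ?W \<omega>)\<^sup>2 \<partial>P)"
      using \<open>\<theta> > 0\<close> by (simp add: divide_le_cancel)
    then have "0 \<le> t * (2 * a + t * b)"
      unfolding W2 by (simp add: power2_eq_square algebra_simps)
    then show ?thesis using t by (simp add: zero_le_mult_iff)
  qed
  have "0 \<le> a"
  proof (rule ccontr)
    assume "\<not> 0 \<le> a"
    \<comment> \<open>The quotient gives tb \<le> -a, so that 2a + tb \<le> a < 0 contradicts
      \<open>key\<close>. Adding 1 to \<open>b\<close> covers b = 0, and the minimum with 1 keeps
      the point on the segment.\<close>
    define t where "t = min 1 (- a / (b + 1))"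
    have "0 < t" "t \<le> 1" using \<open>\<not> 0 \<le> a\<close> b by (auto simp: t_def divide_neg_pos)
    moreover have "t * b \<le> - a"
    proof -
      have "t * b \<le> - a / (b + 1) * b" using b by (intro mult_right_mono) (auto simp: t_def)
      also have "\<dots> \<le> - a" using b \<open>\<not> 0 \<le> a\<close> by (simp add: field_simps)
      finally show ?thesis .
    qed
    ultimately show False using key[of t] \<open>\<not> 0 \<le> a\<close> by linarith
  qed
  also have "a = (\<integral>\<omega>. ?R \<omega> * Z' \<omega> \<partial>P) - (\<integral>\<omega>. ?R \<omega> * Z \<omega> \<partial>P)"
    unfolding a_def H_def right_diff_distrib
    by (intro Bochner_Integration.integral_diff L2_mult_integrable R L)
  finally show ?thesis by simp
qed

text \<open>Testing the first-order condition with all densities shows that the residual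
  \<open>R\<close> is almost everywhere at least its \<open>Z\<close>-weighted mean
  \<open>k\<close>. As \<open>Z\<close> charges every non-null set, equality with that mean forces
  \<open>R = k\<close>, and since \<open>R\<close> has \<open>P\<close>-mean zero,
  \<open>k = 0\<close>.\<close>

lemma mv_residual_zero_at_positive_minimiser:
  assumes P: "prob_space P" and "\<theta> > 0" and X: "X \<in> L2 P"
    and Z: "Z \<in> L2_densities P" and Zpos: "AE \<omega> in P. 0 < Z \<omega>"
    and min: "\<And>Z'. Z' \<in> L2_densities P \<Longrightarrow> penalised_at P \<theta> X Z \<le> penalised_at P \<theta> X Z'"
  shows "AE \<omega> in P. mv_residual P \<theta> X Z \<omega> = 0"
proof -
  interpret prob_space P by fact
  let ?R = "mv_residual P \<theta> X Z"
  have ZL: "Z \<in> L2 P" and one: "(\<integral>\<omega>. Z \<omega> \<partial>P) = 1" using Z by (auto simp: L2_densities_def)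
  have R: "?R \<in> L2 P" by (rule mv_residual_L2[OF P X ZL])
  have [measurable]: "?R \<in> borel_measurable P" "Z \<in> borel_measurable P"
    using R ZL by (auto simp: L2_def)
  note [simp] = L2_integrable[OF P ZL] L2_integrable[OF P R] L2_integrable[OF P X]
    L2_mult_integrable[OF R ZL]
  define k where "k = (\<integral>\<omega>. ?R \<omega> * Z \<omega> \<partial>P)"
  \<comment> \<open>The density proportional to \<open>(k - R)\<^sup>+\<close> would violate the first-order condition.\<close>
  define Y where "Y = (\<lambda>\<omega>. max 0 (k - ?R \<omega>))"
  have Y: "Y \<in> L2 P"
  proof -
    have D: "(\<lambda>\<omega>. k - ?R \<omega>) \<in> L2 P" by (intro L2_diff L2_const P R)
    have "integrable P (\<lambda>\<omega>. (Y \<omega>)\<^sup>2)"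
      by (rule Bochner_Integration.integrable_bound[where f = "\<lambda>\<omega>. (k - ?R \<omega>)\<^sup>2"])
        (use D in \<open>auto simp: L2_def Y_def max_def\<close>)
    then show ?thesis by (simp add: L2_def Y_def)
  qed
  note [simp] = L2_integrable[OF P Y] L2_mult_integrable[OF R Y]
  have Y_int0: "(\<integral>\<omega>. Y \<omega> \<partial>P) = 0"
  proof (rule ccontr)
    let ?y = "\<integral>\<omega>. Y \<omega> \<partial>P"
    assume "?y \<noteq> 0"
    moreover have "0 \<le> ?y" by (rule Bochner_Integration.integral_nonneg) (simp add: Y_def)
    ultimately have y: "0 < ?y" by simp
    have "(\<lambda>\<omega>. (1 / ?y) * Y \<omega>) \<in> L2_densities P"
      unfolding L2_densities_def
    proof (intro CollectI conjI L2_cmult Y)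
      show "AE \<omega> in P. 0 \<le> (1 / ?y) * Y \<omega>" using y by (simp add: Y_def)
      show "(\<integral>\<omega>. (1 / ?y) * Y \<omega> \<partial>P) = 1" using y by simp
    qed
    then have "k \<le> (\<integral>\<omega>. ?R \<omega> * ((1 / ?y) * Y \<omega>) \<partial>P)"
      unfolding k_def by (intro penalised_at_minimiser_first_order assms) auto
    then have "k \<le> (\<integral>\<omega>. ?R \<omega> * Y \<omega> \<partial>P) / ?y" by simp
    then have "0 \<le> (\<integral>\<omega>. ?R \<omega> * Y \<omega> \<partial>P) - k * ?y" using y by (simp add: field_simps)
    also have "\<dots> = (\<integral>\<omega>. ?R \<omega> * Y \<omega> - k * Y \<omega> \<partial>P)" by simp
    \<comment> \<open>Where \<open>Y\<close> is positive, R - k = -Y; elsewhere both integrands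
      vanish.\<close>
    also have "\<dots> = (\<integral>\<omega>. - (Y \<omega>)\<^sup>2 \<partial>P)"
      by (intro Bochner_Integration.integral_cong)
        (auto simp: Y_def max_def power2_eq_square algebra_simps)
    finally have "(\<integral>\<omega>. (Y \<omega>)\<^sup>2 \<partial>P) \<le> 0" by simp
    then have "(\<integral>\<omega>. (Y \<omega>)\<^sup>2 \<partial>P) = 0" by (simp add: antisym)
    then have "AE \<omega> in P. (Y \<omega>)\<^sup>2 = 0"
      using Y by (subst (asm) integral_nonneg_eq_0_iff_AE) (auto simp: L2_def)
    then have "AE \<omega> in P. Y \<omega> = 0" by simp
    then have "?y = 0" using integral_eq_zero_AE by blast
    then show False using y by simp
  qed
  have "AE \<omega> in P. Y \<omega> = 0"
    using Y_int0 by (subst (asm) integral_nonneg_eq_0_iff_AE) (auto simp: Y_def[abs_def])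
  then have ge: "AE \<omega> in P. k \<le> ?R \<omega>" by eventually_elim (auto simp: Y_def max_def split: if_splits)
  \<comment> \<open>The integrand (R - k)Z is nonnegative with integral k - k = 0, so it vanishes
    almost everywhere; strict positivity of \<open>Z\<close> then allows division.\<close>
  have "(\<integral>\<omega>. ?R \<omega> * Z \<omega> - k * Z \<omega> \<partial>P) = 0" by (simp add: one flip: k_def)
  moreover have "AE \<omega> in P. 0 \<le> ?R \<omega> * Z \<omega> - k * Z \<omega>"
    using ge Zpos by eventually_elim (simp add: mult_right_mono)
  ultimately have "AE \<omega> in P. ?R \<omega> * Z \<omega> - k * Z \<omega> = 0"
    by (subst (asm) integral_nonneg_eq_0_iff_AE) auto
  then have k: "AE \<omega> in P. ?R \<omega> = k" using Zpos by eventually_elim auto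
  then have "(\<integral>\<omega>. ?R \<omega> \<partial>P) = (\<integral>\<omega>. k \<partial>P)" by (intro integral_cong_AE) auto
  moreover have "(\<integral>\<omega>. ?R \<omega> \<partial>P) = 0"
    unfolding mv_residual_def by (simp add: one prob_space)
  ultimately have "k = 0" by (simp add: prob_space)
  then show ?thesis using k by simp
qed

section \<open>Comparison of the two problems on attainable claims\<close>

lemma mv_utility_eq_penalised_at:
  assumes P: "prob_space P" and "\<theta> > 0" and X: "X \<in> L2 P"
    and Z: "Z \<in> L2 P" "(\<integral>\<omega>. Z \<omega> \<partial>P) = 1"
    and R: "AE \<omega> in P. mv_residual P \<theta> X Z \<omega> = 0"
  shows "mv_utility P \<theta> X = penalised_at P \<theta> X Z"
proof -
  have "(\<integral>\<omega>. (mv_residual P \<theta> X Z \<omega>)\<^sup>2 \<partial>P) = 0"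
    by (rule integral_eq_zero_AE) (use R in simp)
  then show ?thesis using penalised_at_eq[OF P \<open>\<theta> > 0\<close> X Z] by simp
qed

theorem theorem1:
  fixes P :: "'a measure" and \<theta> x0 :: real and M :: "'a \<Rightarrow> real"
  assumes "prob_space P"
    and "\<theta> > 0"
    and "M \<in> borel_measurable P"
    and "AE \<omega> in P. M \<omega> > 0"
    and "integrable P (\<lambda>\<omega>. (M \<omega>)\<^sup>2)"
  shows "\<forall>X. is_arg_max (mv_utility P \<theta>) (\<lambda>Y. Y \<in> attainable P M x0) X
           \<longleftrightarrow> is_arg_max (mmv_utility P \<theta>) (\<lambda>Y. Y \<in> attainable P M x0) X"
proof -
  interpret prob_space P by fact
  note P = assms(1)
  have M_L2: "M \<in> L2 P" using assms by (simp add: L2_def)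
  note iM [simp] = L2_integrable[OF P M_L2]
  define m where "m = (\<integral>\<omega>. M \<omega> \<partial>P)"
  have "m \<noteq> 0"
  proof
    assume "m = 0"
    moreover have "AE \<omega> in P. 0 \<le> M \<omega>" using assms(4) by eventually_elim simp
    ultimately have "AE \<omega> in P. M \<omega> = 0"
      using integral_nonneg_eq_0_iff_AE[OF iM] by (simp add: m_def)
    with assms(4) have "AE \<omega> in P. False" by eventually_elim simp
    then show False by simp
  qed
  moreover have "0 \<le> m"
    unfolding m_def by (rule integral_nonneg_AE) (use assms(4) in \<open>eventually_elim, simp\<close>)
  ultimately have m: "0 < m" by simp
  \<comment> \<open>The normalised kernel is the pricing density: under it every attainable claim
    has the same expectation x0/m, which makes the constant \<open>C\<close> below independent of
    the claim.\<close>
  define Z where "Z = (\<lambda>\<omega>. 1 / m * M \<omega>)"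
  have ZL: "Z \<in> L2 P" unfolding Z_def by (intro L2_cmult M_L2)
  have one: "(\<integral>\<omega>. Z \<omega> \<partial>P) = 1" using m by (simp add: Z_def flip: m_def)
  have Zpos: "AE \<omega> in P. 0 < Z \<omega>" using assms(4) by eventually_elim (simp add: Z_def m)
  then have "AE \<omega> in P. 0 \<le> Z \<omega>" by eventually_elim simp
  then have Z: "Z \<in> L2_densities P" using ZL one by (simp add: L2_densities_def)
  define C where "C = x0 / m + 1 / (2 * \<theta>) * ((\<integral>\<omega>. (Z \<omega>)\<^sup>2 \<partial>P) - 1)"
  have C: "penalised_at P \<theta> X Z = C" if "X \<in> attainable P M x0" for X
  proof -
    have "(\<integral>\<omega>. Z \<omega> * X \<omega> \<partial>P) = 1 / m * (\<integral>\<omega>. M \<omega> * X \<omega> \<partial>P)"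
      unfolding Z_def mult.assoc by (rule integral_mult_right_zero)
    then show ?thesis using that by (simp add: penalised_at_def C_def attainable_def)
  qed
  have L: "X \<in> L2 P" if "X \<in> attainable P M x0" for X using that by (simp add: attainable_def)
  have bounds: "mv_utility P \<theta> X \<le> mmv_utility P \<theta> X" "mmv_utility P \<theta> X \<le> C"
    if "X \<in> attainable P M x0" for X
    using mv_utility_le_mmv_utility[OF P assms(2) L[OF that]]
      mmv_utility_le_penalised_at[OF P assms(2) L[OF that] Z] C[OF that] by auto
  \<comment> \<open>If V(X) = C, then \<open>Z\<close> attains the infimum defining V(X), because
    \<open>C\<close> is the penalised value at \<open>Z\<close>; positivity of \<open>Z\<close> then
    annihilates the residual.\<close>
  have converse: "mv_utility P \<theta> X = C"
    if X: "X \<in> attainable P M x0" and "mmv_utility P \<theta> X = C" for X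
  proof -
    have "AE \<omega> in P. mv_residual P \<theta> X Z \<omega> = 0"
    proof (rule mv_residual_zero_at_positive_minimiser[OF P assms(2) L[OF X] Z Zpos])
      fix Z' assume "Z' \<in> L2_densities P"
      then show "penalised_at P \<theta> X Z \<le> penalised_at P \<theta> X Z'"
        using mmv_utility_le_penalised_at[OF P assms(2) L[OF X]] C[OF X] that(2) by simp
    qed
    then show ?thesis using mv_utility_eq_penalised_at[OF P assms(2) L[OF X] ZL one] C[OF X] by simp
  qed
  \<comment> \<open>Solving Z - 1 + \<theta>(X - E[X]) = 0 for X gives a constant minus Z/\<theta>,
    with the constant left free; \<open>c\<close> is the value that meets the budget
    equation.\<close>
  define c where "c = (x0 + (\<integral>\<omega>. M \<omega> * Z \<omega> \<partial>P) / \<theta>) / m"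
  define X0 where "X0 = (\<lambda>\<omega>. c - 1 / \<theta> * Z \<omega>)"
  have X0L: "X0 \<in> L2 P" unfolding X0_def by (intro L2_diff L2_const L2_cmult P ZL)
  have "(\<integral>\<omega>. M \<omega> * X0 \<omega> \<partial>P) = (\<integral>\<omega>. c * M \<omega> - 1 / \<theta> * (M \<omega> * Z \<omega>) \<partial>P)"
    by (simp add: X0_def algebra_simps)
  also have "\<dots> = c * m - 1 / \<theta> * (\<integral>\<omega>. M \<omega> * Z \<omega> \<partial>P)"
    using L2_mult_integrable[OF M_L2 ZL] by (simp add: m_def)
  also have "\<dots> = x0" using m by (simp add: c_def)
  finally have X0: "X0 \<in> attainable P M x0" using X0L by (simp add: attainable_def)
  have mean: "(\<integral>\<omega>. X0 \<omega> \<partial>P) = c - 1 / \<theta>"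
    using L2_integrable[OF P ZL] by (simp add: X0_def one prob_space)
  have "mv_residual P \<theta> X0 Z \<omega> = 0" for \<omega>
    using assms(2) unfolding mv_residual_def mean by (simp add: X0_def field_simps)
  then have X0C: "mv_utility P \<theta> X0 = C"
    using mv_utility_eq_penalised_at[OF P assms(2) X0L ZL one] C[OF X0] by simp
  \<comment> \<open>An upper bound \<open>C\<close> that is attained at \<open>X0\<close> is the
    maximum, so optimality of a claim means reaching the level \<open>C\<close>. Both problems share
    this level, which leaves only the comparison of level sets in \<open>same\<close>.\<close>
  have arg_max_iff: "is_arg_max f (\<lambda>Y. Y \<in> attainable P M x0) X
      \<longleftrightarrow> X \<in> attainable P M x0 \<and> f X = C"
    if le: "\<And>Y. Y \<in> attainable P M x0 \<Longrightarrow> f Y \<le> C" and eq: "f X0 = C"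
    for f :: "('a \<Rightarrow> real) \<Rightarrow> real" and X
    unfolding is_arg_max_linorder using le X0 unfolding eq[symmetric] by (auto intro: antisym)
  have mv: "mv_utility P \<theta> Y \<le> C" if "Y \<in> attainable P M x0" for Y
    using bounds[OF that] by linarith
  have mmv_X0: "mmv_utility P \<theta> X0 = C"
    using bounds[OF X0] X0C by linarith
  \<comment> \<open>Left to right is the squeeze between the mean-variance value and
    \<open>C\<close>; right to left is \<open>converse\<close>.\<close>
  have same: "mv_utility P \<theta> X = C \<longleftrightarrow> mmv_utility P \<theta> X = C"
    if "X \<in> attainable P M x0" for X
    using bounds[OF that] converse[OF that] by linarith
  have "is_arg_max (mv_utility P \<theta>) (\<lambda>Y. Y \<in> attainable P M x0) X
      \<longleftrightarrow> X \<in> attainable P M x0 \<and> mv_utility P \<theta> X = C" for X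
    by (rule arg_max_iff) (fact mv X0C)+
  moreover have "is_arg_max (mmv_utility P \<theta>) (\<lambda>Y. Y \<in> attainable P M x0) X
      \<longleftrightarrow> X \<in> attainable P M x0 \<and> mmv_utility P \<theta> X = C" for X
    by (rule arg_max_iff) (fact bounds(2) mmv_X0)+
  ultimately show ?thesis using same by auto
qed

end
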